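(* Let $\|\cdot\|$ be a matrix norm on $\mathbb{R}^{3\times3}$. Suppose an algorithm for evaluating $J_3$ is backward stable in the relative deviatoric sense, i.e. there is a constant $C_0$ such that for every $\mathbf A\in\mathbb{R}^{3\times3}$ its computed value $\mathrm{fl}(J_3(\mathbf A))$ satisfies $\mathrm{fl}(J_3(\mathbf A))=J_3(\mathbf A+\delta\mathbf A)$ for some $\delta\mathbf A\in\mathbb{R}^{3\times3}$ with $\|\mathrm{dev}(\delta\mathbf A)\|\le C_0\,\epsilon\,\|\mathrm{dev}(\mathbf A)\|$. Then the algorithm is forward stable in the sense that there is a constant $C$, depending only on $C_0$ and the norm, such that for every $\mathbf A\in\mathbb{R}^{3\times 3}$ $$|\mathrm{fl}(J_3(\mathbf A))-J_3(\mathbf A)|\le C\,\big\|\mathrm{dev}(\mathrm{cof}(\mathrm{dev}(\mathbf A)))\big\|\,\|\mathrm{dev}(\mathbf A)\|\,\epsilon+\mathcal O(\epsilon^2).$$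
   Context: For $\mathbf A\in\mathbb{R}^{3\times3}$, $\mathrm{dev}(\mathbf A)=\mathbf A-\tfrac13\mathrm{tr}(\mathbf A)\mathbf I$, $J_3(\mathbf A)=\det(\mathrm{dev}(\mathbf A))$, and $\mathrm{cof}(\mathbf A)$ is the cofactor matrix (the transpose of the adjugate). $\epsilon>0$ is the unit roundoff of the floating-point arithmetic; $\mathrm{fl}(J_3(\mathbf A))$ denotes the output of the algorithm run in that arithmetic. $\mathcal O(\epsilon^2)$ is understood as $\epsilon\to0$ for fixed $\mathbf A$: a quantity bounded by $K\epsilon^2$ for all sufficiently small $\epsilon$, with $K$ independent of $\epsilon$ (but possibly depending on $\mathbf A$, $C_0$ and the norm). *)

theory Defs
  imports "HOL-Analysis.Analysis"
begin

definition dev :: "real^3^3 \<Rightarrow> real^3^3" where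
  "dev A = A - (trace A / 3) *\<^sub>R mat 1"

definition J3 :: "real^3^3 \<Rightarrow> real" where
  "J3 A = det (dev A)"

(* The determinant below is the signed minor (-1)^(i+j) * M_ij: row i and column j are
   replaced by unit vectors, so expansion along row i leaves exactly that minor. *)
definition cof :: "real^3^3 \<Rightarrow> real^3^3" where
  "cof A = (\<chi> i j. det (\<chi> k l. if k = i \<and> l = j then 1
                               else if k = i \<or> l = j then 0
                               else A $ k $ l))"

lemma matrix_mult_transpose_cof: "A ** transpose (cof A) = mat (det A)"
  by (simp add: cof_def matrix_matrix_mult_def transpose_def mat_def vec_eq_iff
      forall_3 sum_3 det_3 algebra_simps)

(* Any norm on the vector space of matrices; submultiplicativity is not required. *)
definition matrix_norm :: "(real^3^3 \<Rightarrow> real) \<Rightarrow> bool" where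
  "matrix_norm N \<longleftrightarrow>
     (\<forall>A. 0 \<le> N A) \<and>
     (\<forall>A. N A = 0 \<longleftrightarrow> A = 0) \<and>
     (\<forall>c A. N (c *\<^sub>R A) = \<bar>c\<bar> * N A) \<and>
     (\<forall>A B. N (A + B) \<le> N A + N B)"

(* fl \<epsilon> A is the value computed for A in the arithmetic with unit roundoff \<epsilon>, and U is
   the set of unit roundoffs for which the algorithm is available (for instance the powers
   of 2, or all positive reals). The constant C0 is uniform in \<epsilon> and A. *)
definition dev_backward_stable ::
  "(real^3^3 \<Rightarrow> real) \<Rightarrow> real \<Rightarrow> real set \<Rightarrow> (real \<Rightarrow> real^3^3 \<Rightarrow> real) \<Rightarrow> bool" where
  "dev_backward_stable N C0 U fl \<longleftrightarrow>
     (\<forall>\<epsilon>\<in>U. \<forall>A. \<exists>\<delta>A. fl \<epsilon> A = J3 (A + \<delta>A) \<and> N (dev \<delta>A) \<le> C0 * \<epsilon> * N (dev A))"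

end

theory Submission
  imports Defs
begin

text \<open>
  Put \<open>D = dev A\<close> and \<open>E = dev \<delta>A\<close>, so that \<open>J3 (A + \<delta>A) = det (D + E)\<close>. In dimension three
  the determinant expands exactly as \<open>det D + cof D : E + D : cof E + det E\<close>, where \<open>:\<close> is the
  Frobenius inner product. As \<open>E\<close> is trace free, only the deviatoric part of \<open>cof D\<close> contributes
  to the linear term, and Cauchy--Schwarz bounds it. The other two terms are of second and third
  order in \<open>E\<close>. Equivalence of norms transfers the bounds from the Frobenius norm to \<open>N\<close>.
\<close>

text \<open>In finite dimension \<open>N\<close> is convex, hence continuous, and attains a positive
  minimum on the compact unit sphere; its reciprocal serves as \<open>b\<close>, and homogeneity
  extends the bound to all vectors.\<close>

lemma norm_le_definite_seminorm:
  fixes N :: "'a::euclidean_space \<Rightarrow> real"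
  assumes pos: "\<And>x. x \<noteq> 0 \<Longrightarrow> 0 < N x"
    and scale: "\<And>c x. N (c *\<^sub>R x) = \<bar>c\<bar> * N x"
    and triangle: "\<And>x y. N (x + y) \<le> N x + N y"
  obtains b where "0 < b" "\<And>x. norm x \<le> b * N x"
proof -
  have "convex_on UNIV N"
  proof (rule convex_onI)
    fix t :: real and x y
    assume "0 < t" "t < 1"
    then show "N ((1 - t) *\<^sub>R x + t *\<^sub>R y) \<le> (1 - t) * N x + t * N y"
      using triangle[of "(1 - t) *\<^sub>R x" "t *\<^sub>R y"] by (simp add: scale)
  qed simp
  then have "continuous_on UNIV N"
    by (intro convex_on_continuous) auto
  then have "continuous_on (sphere 0 1) N"
    by (rule continuous_on_subset) simp
  then obtain z where z: "norm z = 1" and min: "\<And>x. norm x = 1 \<Longrightarrow> N z \<le> N x"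
    using continuous_attains_inf[of "sphere 0 1" N] by auto
  have Nz: "0 < N z"
    using z by (intro pos) auto
  show thesis
  proof
    show "0 < inverse (N z)"
      using Nz by simp
    show "norm x \<le> inverse (N z) * N x" for x
    proof (cases "x = 0")
      case True
      then show ?thesis
        using scale[of 0 x] by simp
    next
      case False
      then have "N z \<le> N (inverse (norm x) *\<^sub>R x)"
        by (intro min) simp
      also have "\<dots> = N x / norm x"
        by (simp add: scale field_simps)
      finally show ?thesis
        using False Nz by (simp add: field_simps)
    qed
  qed
qed

lemma dev_add: "dev (A + B) = dev A + dev B"
  by (simp add: dev_def trace_add add_divide_distrib scaleR_left_distrib)

lemma trace_dev [simp]: "trace (dev A) = 0"
  by (simp add: dev_def trace_def sum_3 mat_def field_simps)

text \<open>\<open>dev\<close> subtracts a multiple of the identity, whose inner product with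
  \<open>B\<close> is the trace of \<open>B\<close>.\<close>

lemma inner_dev_left:
  assumes "trace B = 0"
  shows "dev A \<bullet> B = A \<bullet> B"
proof -
  have "mat 1 \<bullet> B = trace B"
    by (simp add: inner_vec_def trace_def sum_3 mat_def)
  with assms show ?thesis
    by (simp add: dev_def inner_diff_left)
qed

lemma det_add_3:
  fixes A B :: "real^3^3"
  shows "det (A + B) = det A + cof A \<bullet> B + A \<bullet> cof B + det B"
  by (simp add: cof_def det_3 inner_vec_def sum_3 algebra_simps)

text \<open>Each row of \<open>A\<close> contributes one Laplace expansion of the determinant. This
  turns a bound on \<open>cof\<close> into a bound on \<open>det\<close>.\<close>

lemma inner_cof_self: "A \<bullet> cof A = 3 * det A"
  by (simp add: cof_def det_3 inner_vec_def sum_3 algebra_simps)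

text \<open>The indices are added modulo 3, which absorbs the sign of the cofactor.\<close>

lemma cof_nth:
  "cof A $ i $ j = A $ (i + 1) $ (j + 1) * A $ (i + 2) $ (j + 2)
    - A $ (i + 1) $ (j + 2) * A $ (i + 2) $ (j + 1)"
proof -
  \<comment> \<open>Indices of type \<open>3\<close> run over 1, 2, 3, so adding 1 or 2 can produce
    the numerals 4 and 5.\<close>
  have mod_3: "(4::3) = 1" "(5::3) = 2"
    by simp_all
  have "\<forall>i j. cof A $ i $ j = A $ (i + 1) $ (j + 1) * A $ (i + 2) $ (j + 2)
    - A $ (i + 1) $ (j + 2) * A $ (i + 2) $ (j + 1)"
    by (simp add: forall_3 cof_def det_3 mod_3)
  then show ?thesis
    by blast
qed

text \<open>Nine entries, each a difference of two products bounded by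
  \<open>(norm A)\<^sup>2\<close>, give 18. The crude constant is harmless: it enters only the
  second-order coefficient \<open>K\<close>.\<close>

lemma norm_cof_le: "norm (cof A) \<le> 18 * (norm A)\<^sup>2"
proof -
  have entry: "\<bar>A $ i $ j\<bar> \<le> norm A" for i j
    using component_le_norm_cart[of "A $ i" j] Finite_Cartesian_Product.norm_nth_le[of A i]
    by (rule order_trans)
  have prod: "\<bar>A $ i $ j * A $ k $ l\<bar> \<le> (norm A)\<^sup>2" for i j k l
    unfolding abs_mult power2_eq_square by (intro mult_mono entry) auto
  have cof_entry: "norm (cof A $ i $ j) \<le> 2 * (norm A)\<^sup>2" for i j
    using prod[of "i + 1" "j + 1" "i + 2" "j + 2"] prod[of "i + 1" "j + 2" "i + 2" "j + 1"]
    unfolding cof_nth real_norm_def by linarith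
  have "norm (cof A) \<le> (\<Sum>i\<in>UNIV. norm (cof A $ i))"
    unfolding norm_vec_def by (intro L2_set_le_sum) simp
  also have "\<dots> \<le> (\<Sum>i\<in>UNIV. \<Sum>j\<in>UNIV. norm (cof A $ i $ j))"
    unfolding norm_vec_def by (intro sum_mono L2_set_le_sum) simp
  also have "\<dots> \<le> (\<Sum>i\<in>(UNIV::3 set). \<Sum>j\<in>(UNIV::3 set). 2 * (norm A)\<^sup>2)"
    by (intro sum_mono cof_entry)
  finally show ?thesis
    by simp
qed

lemma abs_det_add_diff_le:
  fixes D E :: "real^3^3"
  assumes "trace E = 0"
  shows "\<bar>det (D + E) - det D\<bar>
    \<le> norm (dev (cof D)) * norm E + 18 * norm D * (norm E)\<^sup>2 + 6 * norm E ^ 3"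
proof -
  have cof_bound: "\<bar>X \<bullet> cof E\<bar> \<le> 18 * norm X * (norm E)\<^sup>2" for X
  proof -
    have "\<bar>X \<bullet> cof E\<bar> \<le> norm X * norm (cof E)"
      by (rule Cauchy_Schwarz_ineq2)
    also have "\<dots> \<le> norm X * (18 * (norm E)\<^sup>2)"
      by (intro mult_left_mono norm_cof_le) simp
    finally show ?thesis
      by simp
  qed
  have "\<bar>dev (cof D) \<bullet> E\<bar> \<le> norm (dev (cof D)) * norm E"
    by (rule Cauchy_Schwarz_ineq2)
  \<comment> \<open>The determinant of \<open>E\<close> is a third of
    \<open>E \<bullet> cof E\<close>, so 18 becomes the 6 of the cubic term.\<close>
  moreover have "3 * \<bar>det E\<bar> \<le> 18 * norm E ^ 3"
    using cof_bound[of E] by (simp add: inner_cof_self abs_mult power3_eq_cube power2_eq_square)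
  ultimately show ?thesis
    using cof_bound[of D] unfolding det_add_3 inner_dev_left[OF assms] by linarith
qed

theorem lemma8:
  fixes N :: "real^3^3 \<Rightarrow> real" and C0 :: real
  assumes "matrix_norm N"
  shows "\<exists>(C::real) (K :: real^3^3 \<Rightarrow> real).
           \<forall>(U :: real set) (fl :: real \<Rightarrow> real^3^3 \<Rightarrow> real).
             U \<subseteq> {0<..} \<longrightarrow> dev_backward_stable N C0 U fl \<longrightarrow>
             (\<forall>A. \<forall>\<^sub>F \<epsilon> in at 0 within U.
                \<bar>fl \<epsilon> A - J3 A\<bar> \<le> C * N (dev (cof (dev A))) * N (dev A) * \<epsilon> + K A * \<epsilon>\<^sup>2)"
proof -
  have N_nonneg: "0 \<le> N X" and N_zero: "N X = 0 \<longleftrightarrow> X = 0"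
    and N_scale: "N (c *\<^sub>R X) = \<bar>c\<bar> * N X" and N_triangle: "N (X + Y) \<le> N X + N Y" for c X Y
    using assms by (auto simp: matrix_norm_def)
  obtain b where "0 < b" and b: "\<And>X. norm X \<le> b * N X"
    using norm_le_definite_seminorm[of N] N_nonneg N_zero N_scale N_triangle
    by (metis order_less_le)
  \<comment> \<open>\<open>r A * \<epsilon>\<close> will bound the Frobenius norm of
    \<open>dev \<delta>A\<close>. The absolute value keeps \<open>r A\<close> nonnegative whatever
    the sign of \<open>C0\<close>.\<close>
  define r where "r A = b * \<bar>C0\<bar> * N (dev A)" for A
  define K where "K A = 18 * norm (dev A) * (r A)\<^sup>2 + 6 * r A ^ 3" for A
  \<comment> \<open>In the constant \<open>b\<^sup>2 * \<bar>C0\<bar>\<close>, one factor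
    \<open>b\<close> converts the norm of \<open>dev (cof (dev A))\<close> and the other that of
    \<open>dev \<delta>A\<close>.\<close>
  have bound: "\<bar>fl \<epsilon> A - J3 A\<bar>
      \<le> b\<^sup>2 * \<bar>C0\<bar> * N (dev (cof (dev A))) * N (dev A) * \<epsilon> + K A * \<epsilon>\<^sup>2"
    if stable: "dev_backward_stable N C0 U fl" and "\<epsilon> \<in> U" "0 < \<epsilon>" "\<epsilon> < 1" for U fl \<epsilon> A
  proof -
    define D where "D = dev A"
    obtain \<delta>A where fl: "fl \<epsilon> A = J3 (A + \<delta>A)" and le: "N (dev \<delta>A) \<le> C0 * \<epsilon> * N D"
      using stable \<open>\<epsilon> \<in> U\<close> unfolding dev_backward_stable_def D_def by blast
    define E where "E = dev \<delta>A"
    have r: "0 \<le> r A"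
      using \<open>0 < b\<close> N_nonneg by (simp add: r_def)
    have "C0 * \<epsilon> * N D \<le> \<bar>C0\<bar> * \<epsilon> * N D"
      using \<open>0 < \<epsilon>\<close> N_nonneg by (intro mult_right_mono) auto
    with le have "b * N E \<le> b * (\<bar>C0\<bar> * \<epsilon> * N D)"
      using \<open>0 < b\<close> unfolding E_def by (intro mult_left_mono) auto
    then have E: "norm E \<le> r A * \<epsilon>"
      using b[of E] by (simp add: r_def D_def mult_ac)
    have linear: "norm (dev (cof D)) * norm E \<le> b * N (dev (cof D)) * (r A * \<epsilon>)"
      using \<open>0 < b\<close> N_nonneg by (intro mult_mono b E) auto
    have quadratic: "(norm E)\<^sup>2 \<le> (r A)\<^sup>2 * \<epsilon>\<^sup>2"
      using power_mono[OF E, of 2] by (simp add: power_mult_distrib)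
    have "norm E ^ 3 \<le> r A ^ 3 * \<epsilon> ^ 3"
      using power_mono[OF E, of 3] by (simp add: power_mult_distrib)
    \<comment> \<open>Since \<open>\<epsilon> < 1\<close>, the cubic term is absorbed into the
      quadratic one.\<close>
    also have "\<dots> \<le> r A ^ 3 * \<epsilon>\<^sup>2"
      using r \<open>0 < \<epsilon>\<close> \<open>\<epsilon> < 1\<close> by (intro mult_left_mono power_decreasing) auto
    finally have cubic: "norm E ^ 3 \<le> r A ^ 3 * \<epsilon>\<^sup>2" .
    have "\<bar>fl \<epsilon> A - J3 A\<bar> = \<bar>det (D + E) - det D\<bar>"
      by (simp add: fl J3_def dev_add D_def E_def)
    also have "\<dots> \<le> norm (dev (cof D)) * norm E + 18 * norm D * (norm E)\<^sup>2 + 6 * norm E ^ 3"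
      by (rule abs_det_add_diff_le) (simp add: E_def)
    also have "\<dots> \<le> b * N (dev (cof D)) * (r A * \<epsilon>)
        + 18 * norm D * ((r A)\<^sup>2 * \<epsilon>\<^sup>2) + 6 * (r A ^ 3 * \<epsilon>\<^sup>2)"
      by (intro add_mono mult_left_mono linear quadratic cubic) auto
    also have "\<dots> = b\<^sup>2 * \<bar>C0\<bar> * N (dev (cof D)) * N D * \<epsilon> + K A * \<epsilon>\<^sup>2"
      by (simp add: K_def r_def D_def power2_eq_square algebra_simps)
    finally show ?thesis
      by (simp add: D_def)
  qed
  have "\<forall>\<^sub>F \<epsilon> in at 0 within U. \<bar>fl \<epsilon> A - J3 A\<bar>
      \<le> b\<^sup>2 * \<bar>C0\<bar> * N (dev (cof (dev A))) * N (dev A) * \<epsilon> + K A * \<epsilon>\<^sup>2"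
    if "U \<subseteq> {0<..}" "dev_backward_stable N C0 U fl" for U fl A
    unfolding eventually_at using that bound
    \<comment> \<open>Radius 1 supplies \<open>\<epsilon> < 1\<close>; positivity comes from
      \<open>U \<subseteq> {0<..}\<close>.\<close>
    by (intro exI[of _ 1]) (auto simp: dist_real_def)
  then show ?thesis
    by blast
qed

end
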